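(* Let $G$ be a group acting on a field $L$ by automorphisms, let $K\subseteq L^G$ be a subring, and let $R=K[a_1,\dots,a_n]\subseteq L$ be a finitely generated $G$-stable $K$-subalgebra with $\operatorname{Quot}(R)=L$. Assume that $B\subseteq R^G$ is a finitely generated $K$-subalgebra such that $R^G_a=B_a$ with $a\in B$ nonzero. Define an ascending chain of subalgebras $B_0,B_1,B_2,\dots\subseteq R$ by setting $B_0:=B$ and taking $B_{k+1}$ to be the $K$-subalgebra generated by $a^{-1}B_k\cap R$. Then \[ R^G=\bigcup_{k=0}^\infty B_k. \] If $K$ is Noetherian, then all $B_k$ are finitely generated (as $K$-algebras). If $B_k=B_{k+1}$ for some $k$, then $R^G=B_k$. If $R^G$ is finitely generated (as a $K$-algebra), then such a $k$ exists.
   Context: Rings are commutative with identity. $\operatorname{Quot}$ denotes the field of fractions. $B_a:=B[a^{-1}]\subseteq L$ and $R^G_a:=(R^G)[a^{-1}]\subseteq L$ for the nonzero element $a$ (not to be confused with the members $B_k$ of the chain, $k$ a nonnegative integer). $a^{-1}B_k=\{a^{-1}b\mid b\in B_k\}\subseteq L$. *)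

theory Defs
  imports "HOL-Algebra.Algebra"
begin

text \<open>All rings are carried by subsets of the carrier of one ambient ring \<open>L\<close>. For a subring \<open>K\<close>
  of \<open>L\<close>, a \<open>K\<close>-subalgebra of \<open>L\<close> is a subring of \<open>L\<close> containing \<open>K\<close>; the locale \<open>subalgebra\<close>
  of HOL-Algebra is not used because it only asks for closure under scalar multiplication.\<close>

definition ring_subalgebra :: "('l, 'm) ring_scheme \<Rightarrow> 'l set \<Rightarrow> 'l set \<Rightarrow> bool"
  where "ring_subalgebra L K A \<longleftrightarrow> subring A L \<and> K \<subseteq> A"

definition generate_algebra :: "('l, 'm) ring_scheme \<Rightarrow> 'l set \<Rightarrow> 'l set \<Rightarrow> 'l set"
  where "generate_algebra L K S = generate_ring L (K \<union> S)"

definition fin_gen_algebra :: "('l, 'm) ring_scheme \<Rightarrow> 'l set \<Rightarrow> 'l set \<Rightarrow> bool"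
  where "fin_gen_algebra L K A \<longleftrightarrow>
    (\<exists>S. finite S \<and> S \<subseteq> carrier L \<and> A = generate_algebra L K S)"

text \<open>The field of fractions of a subring \<open>A\<close> of a field \<open>L\<close>, formed inside \<open>L\<close>.\<close>

definition quot_field :: "('l, 'm) ring_scheme \<Rightarrow> 'l set \<Rightarrow> 'l set"
  where "quot_field L A = {x \<otimes>\<^bsub>L\<^esub> inv\<^bsub>L\<^esub> y | x y. x \<in> A \<and> y \<in> A \<and> y \<noteq> \<zero>\<^bsub>L\<^esub>}"

text \<open>\<open>A[a\<^sup>-\<^sup>1]\<close> as a subring of \<open>L\<close>, for a subring \<open>A\<close> of \<open>L\<close> and an invertible \<open>a\<close>.\<close>

definition localize_at :: "('l, 'm) ring_scheme \<Rightarrow> 'l set \<Rightarrow> 'l \<Rightarrow> 'l set"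
  where "localize_at L A a = generate_ring L (A \<union> {inv\<^bsub>L\<^esub> a})"

locale field_action = field L + group_action G "carrier L" \<phi>
  for L :: "('l, 'm) ring_scheme" (structure)
    and G :: "('g, 'n) monoid_scheme"
    and \<phi> :: "'g \<Rightarrow> 'l \<Rightarrow> 'l" +
  assumes acts_by_automorphisms: "g \<in> carrier G \<Longrightarrow> \<phi> g \<in> ring_iso L L"

definition fixed_points :: "('g, 'n) monoid_scheme \<Rightarrow> ('g \<Rightarrow> 'l \<Rightarrow> 'l) \<Rightarrow> 'l set \<Rightarrow> 'l set"
  where "fixed_points G \<phi> A = {x \<in> A. \<forall>g \<in> carrier G. \<phi> g x = x}"

primrec algebra_chain ::
  "('l, 'm) ring_scheme \<Rightarrow> 'l set \<Rightarrow> 'l set \<Rightarrow> 'l \<Rightarrow> 'l set \<Rightarrow> nat \<Rightarrow> 'l set"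
  where
    "algebra_chain L K R a B 0 = B"
  | "algebra_chain L K R a B (Suc k) =
       generate_algebra L K
         ({inv\<^bsub>L\<^esub> a \<otimes>\<^bsub>L\<^esub> b | b. b \<in> algebra_chain L K R a B k} \<inter> R)"

end

theory Submission
  imports Defs
begin

text \<open>An element \<open>x\<close> of \<open>R\<^sup>G\<close> lies in \<open>B[a\<^sup>-\<^sup>1]\<close>, so \<open>a\<^sup>k x \<in> B\<close> for some \<open>k\<close>. Each step of the chain
  allows one division by \<open>a\<close>, as long as the quotient stays in \<open>R\<close>, and all the elements
  \<open>a\<^sup>j x\<close> do lie in \<open>R\<close>; hence \<open>x \<in> B\<^sub>k\<close>. Conversely, a division by the invariant element \<open>a\<close>
  preserves invariance, so the chain never leaves \<open>R\<^sup>G\<close>. The two claims about stationarity are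
  formal consequences: a chain that stops once is constant from there on, and finitely many
  generators of the union already lie in a single member.

  The finiteness claim rests on the Hilbert basis theorem. If \<open>K\<close> is Noetherian and \<open>A = B\<^sub>k\<close> is
  finitely generated over \<open>K\<close>, then \<open>A\<close> is Noetherian, so its ideal \<open>A \<inter> aR\<close> is generated
  by finitely many elements \<open>b\<^sub>1, \<dots>, b\<^sub>m\<close>, and \<open>B\<^sub>k\<^sub>+\<^sub>1\<close> is generated over \<open>A\<close> by the quotients
  \<open>a\<^sup>-\<^sup>1 b\<^sub>i\<close>.

  The Hilbert basis theorem is proved for an extension \<open>A[x]\<close> inside an ambient
  commutative ring, where \<open>x\<close> may well satisfy algebraic relations over \<open>A\<close>. The classical
  argument with leading coefficients survives, because it never uses that the coefficients of a
  polynomial expression are unique.\<close>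

section \<open>Ideals of subrings and the Noetherian property\<close>

lemma finite_subset_mono_Union:
  fixes C :: "nat \<Rightarrow> 'a set"
  assumes "finite S" and mono: "\<And>m n. m \<le> n \<Longrightarrow> C m \<subseteq> C n" and "S \<subseteq> (\<Union>n. C n)"
  shows "\<exists>n. S \<subseteq> C n"
  using assms(1,3)
proof (induction rule: finite_induct)
  case (insert s S)
  then obtain k m where "S \<subseteq> C k" "s \<in> C m" by blast
  then have "insert s S \<subseteq> C (max k m)"
    using mono[of k "max k m"] mono[of m "max k m"] by auto
  then show ?case by blast
qed blast

context cring
begin

lemma ideal_subringI:
  assumes A: "subring A R" and IA: "I \<subseteq> A" and z: "\<zero> \<in> I"
    and add: "\<And>x y. x \<in> I \<Longrightarrow> y \<in> I \<Longrightarrow> x \<oplus> y \<in> I"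
    and mult: "\<And>r x. r \<in> A \<Longrightarrow> x \<in> I \<Longrightarrow> r \<otimes> x \<in> I"
  shows "ideal I (R\<lparr>carrier := A\<rparr>)"
proof -
  interpret S: ring "R\<lparr>carrier := A\<rparr>"
    by (rule subring_is_ring[OF A])
  note Ac = subringE(1)[OF A]
  have "subgroup I (add_monoid (R\<lparr>carrier := A\<rparr>))"
  proof (rule group.subgroupI)
    show "group (add_monoid (R\<lparr>carrier := A\<rparr>))"
      by (rule S.add.group_axioms)
    fix x assume x: "x \<in> I"
    then have xA: "x \<in> A" using IA by blast
    have "\<ominus> \<one> \<otimes> x = \<ominus> x"
      using xA Ac by (simp add: l_minus subsetD)
    then have m: "\<ominus> x \<in> I"
      using mult[OF subringE(5)[OF A subringE(3)[OF A]] x] by simp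
    have "\<ominus>\<^bsub>R\<lparr>carrier := A\<rparr>\<^esub> x = \<ominus> x"
      by (rule S.minus_equality) (use xA m IA Ac in \<open>auto simp: l_neg subsetD\<close>)
    then show "inv\<^bsub>add_monoid (R\<lparr>carrier := A\<rparr>)\<^esub> x \<in> I"
      using m by (simp add: a_inv_def)
  qed (use IA z add in auto)
  then show ?thesis
  proof (rule idealI[OF S.ring_axioms])
    fix b r assume b: "b \<in> I" and "r \<in> carrier (R\<lparr>carrier := A\<rparr>)"
    then have r: "r \<in> A" by simp
    show "r \<otimes>\<^bsub>R\<lparr>carrier := A\<rparr>\<^esub> b \<in> I"
      using mult[OF r b] by simp
    moreover have "b \<otimes> r = r \<otimes> b"
      by (rule m_comm) (use b r IA Ac in auto)
    ultimately show "b \<otimes>\<^bsub>R\<lparr>carrier := A\<rparr>\<^esub> r \<in> I"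
      by simp
  qed
qed

lemma ideal_subringD:
  assumes "ideal I (R\<lparr>carrier := A\<rparr>)"
  shows "I \<subseteq> A" and "\<zero> \<in> I"
    and "\<And>x y. x \<in> I \<Longrightarrow> y \<in> I \<Longrightarrow> x \<oplus> y \<in> I"
    and "\<And>r x. r \<in> A \<Longrightarrow> x \<in> I \<Longrightarrow> r \<otimes> x \<in> I"
proof -
  interpret S: ideal I "R\<lparr>carrier := A\<rparr>" by fact
  show "I \<subseteq> A" using S.a_subset by simp
  show "\<zero> \<in> I" using additive_subgroup.zero_closed[OF S.is_additive_subgroup] by simp
  show "x \<oplus> y \<in> I" if "x \<in> I" "y \<in> I" for x y
    using additive_subgroup.a_closed[OF S.is_additive_subgroup that] by simp
  show "r \<otimes> x \<in> I" if "r \<in> A" "x \<in> I" for r x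
    using S.I_l_closed[of x r] that by simp
qed

end

text \<open>The next two lemmas characterise the Noetherian property by a universal property of a finite
  set of generators, so that no linear combinations of generators need to be written down.\<close>

lemma (in ring) noetherian_ringI_witness:
  assumes "\<And>I. ideal I R \<Longrightarrow>
    \<exists>S \<subseteq> I. finite S \<and> (\<forall>J. ideal J R \<longrightarrow> J \<subseteq> I \<longrightarrow> S \<subseteq> J \<longrightarrow> I \<subseteq> J)"
  shows "noetherian_ring R"
proof (rule noetherian_ringI)
  fix I assume I: "ideal I R"
  then obtain S where S: "S \<subseteq> I" "finite S"
      "\<And>J. ideal J R \<Longrightarrow> J \<subseteq> I \<Longrightarrow> S \<subseteq> J \<Longrightarrow> I \<subseteq> J"
    using assms by blast
  have Sc: "S \<subseteq> carrier R"
    using S(1) ideal.Icarr[OF I] by blast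
  have "Idl S \<subseteq> I" by (rule genideal_minimal[OF I S(1)])
  moreover from this have "I \<subseteq> Idl S"
    by (rule S(3)[OF genideal_ideal[OF Sc] _ genideal_self[OF Sc]])
  ultimately show "\<exists>A \<subseteq> carrier R. finite A \<and> I = Idl A"
    using Sc S(2) by blast
qed

lemma (in noetherian_ring) obtain_ideal_generators:
  assumes "ideal I R"
  obtains S where "finite S" "S \<subseteq> I" "\<And>J. ideal J R \<Longrightarrow> S \<subseteq> J \<Longrightarrow> I \<subseteq> J"
proof -
  obtain S where S: "S \<subseteq> carrier R" "finite S" "I = Idl S"
    using finetely_gen[OF assms] by blast
  then have "S \<subseteq> I" "\<And>J. ideal J R \<Longrightarrow> S \<subseteq> J \<Longrightarrow> I \<subseteq> J"
    using genideal_self genideal_minimal by blast+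
  with S(2) show ?thesis using that by blast
qed

section \<open>The Hilbert basis theorem inside an ambient ring\<close>

text \<open>The values at \<open>x\<close> of the polynomials over \<open>A\<close> of degree strictly below \<open>n\<close>.\<close>

primrec poly_values :: "('a, 'b) ring_scheme \<Rightarrow> 'a set \<Rightarrow> 'a \<Rightarrow> nat \<Rightarrow> 'a set"
  where
    "poly_values R A x 0 = {\<zero>\<^bsub>R\<^esub>}"
  | "poly_values R A x (Suc n) =
      {p \<oplus>\<^bsub>R\<^esub> c \<otimes>\<^bsub>R\<^esub> x [^]\<^bsub>R\<^esub> n | p c. p \<in> poly_values R A x n \<and> c \<in> A}"

text \<open>The possible coefficients of \<open>x\<^sup>n\<close> in expressions of degree at most \<open>n\<close> for elements of \<open>I\<close>.
  One element may contribute several coefficients, since \<open>x\<close> need not be transcendental.\<close>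

definition leading_coeffs ::
  "('a, 'b) ring_scheme \<Rightarrow> 'a set \<Rightarrow> 'a \<Rightarrow> 'a set \<Rightarrow> nat \<Rightarrow> 'a set"
  where "leading_coeffs R A x I n =
    {c \<in> A. \<exists>p \<in> poly_values R A x n. p \<oplus>\<^bsub>R\<^esub> c \<otimes>\<^bsub>R\<^esub> x [^]\<^bsub>R\<^esub> n \<in> I}"

locale simple_ring_extension = cring +
  fixes A x
  assumes A: "subring A R" and x: "x \<in> carrier R"
begin

abbreviation "P \<equiv> poly_values R A x"
abbreviation "Ax \<equiv> generate_ring R (insert x A)"
abbreviation "LC \<equiv> leading_coeffs R A x"

lemma A_carrier: "c \<in> A \<Longrightarrow> c \<in> carrier R"
  using subringE(1)[OF A] by blast

lemma P_carrier: "p \<in> P n \<Longrightarrow> p \<in> carrier R"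
proof (induction n arbitrary: p)
  case (Suc n)
  then show ?case using x A_carrier by auto
qed simp

lemma P_zero: "\<zero> \<in> P n"
proof (induction n)
  case (Suc n)
  have "\<zero> = \<zero> \<oplus> \<zero> \<otimes> x [^] n" using x by simp
  with Suc subringE(2)[OF A] show ?case by auto
qed simp

lemma P_add: "p \<in> P n \<Longrightarrow> q \<in> P n \<Longrightarrow> p \<oplus> q \<in> P n"
proof (induction n arbitrary: p q)
  case (Suc n)
  then obtain p' c q' d where
    p: "p' \<in> P n" "c \<in> A" "p = p' \<oplus> c \<otimes> x [^] n" and
    q: "q' \<in> P n" "d \<in> A" "q = q' \<oplus> d \<otimes> x [^] n" by auto
  have carr: "p' \<in> carrier R" "q' \<in> carrier R" "c \<in> carrier R" "d \<in> carrier R"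
      "x [^] n \<in> carrier R"
    using p q P_carrier A_carrier x by auto
  have "p \<oplus> q = (p' \<oplus> q') \<oplus> (c \<oplus> d) \<otimes> x [^] n"
    unfolding p q using carr by algebra
  moreover have "p' \<oplus> q' \<in> P n" "c \<oplus> d \<in> A"
    using Suc.IH p q subringE(7)[OF A] by auto
  ultimately show ?case by auto
qed simp

lemma P_smult: "r \<in> A \<Longrightarrow> p \<in> P n \<Longrightarrow> r \<otimes> p \<in> P n"
proof (induction n arbitrary: p)
  case (Suc n)
  then obtain p' c where p: "p' \<in> P n" "c \<in> A" "p = p' \<oplus> c \<otimes> x [^] n" by auto
  have carr: "p' \<in> carrier R" "c \<in> carrier R" "r \<in> carrier R" "x [^] n \<in> carrier R"
    using p Suc.prems P_carrier A_carrier x by auto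
  have "r \<otimes> p = r \<otimes> p' \<oplus> (r \<otimes> c) \<otimes> x [^] n"
    unfolding p using carr by algebra
  moreover have "r \<otimes> p' \<in> P n" "r \<otimes> c \<in> A"
    using Suc.IH Suc.prems p subringE(6)[OF A] by auto
  ultimately show ?case by auto
qed (use A_carrier in auto)

lemma P_shift: "p \<in> P n \<Longrightarrow> x \<otimes> p \<in> P (Suc n)"
proof (induction n arbitrary: p)
  case 0
  then have "x \<otimes> p = \<zero>" using x by simp
  then show ?case using P_zero[of "Suc 0"] by simp
next
  case (Suc n)
  then obtain p' c where p: "p' \<in> P n" "c \<in> A" "p = p' \<oplus> c \<otimes> x [^] n" by auto
  have carr: "p' \<in> carrier R" "c \<in> carrier R" "x [^] n \<in> carrier R"
    using p P_carrier A_carrier x by auto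
  have "x \<otimes> p = x \<otimes> p' \<oplus> c \<otimes> (x [^] n \<otimes> x)"
    unfolding p using carr x by algebra
  then have "x \<otimes> p = x \<otimes> p' \<oplus> c \<otimes> x [^] Suc n" by simp
  with Suc.IH[OF p(1)] p(2) show ?case unfolding poly_values.simps(2)[of R A x "Suc n"] by blast
qed

lemma P_Suc: "P n \<subseteq> P (Suc n)"
proof
  fix p assume p: "p \<in> P n"
  then have "p = p \<oplus> \<zero> \<otimes> x [^] n" using x P_carrier by simp
  with p subringE(2)[OF A] show "p \<in> P (Suc n)" by auto
qed

lemma P_mono: "m \<le> n \<Longrightarrow> P m \<subseteq> P n"
  by (rule lift_Suc_mono_le[of P, OF P_Suc])

lemma P_pow_mult: "p \<in> P n \<Longrightarrow> x [^] m \<otimes> p \<in> P (n + m)"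
proof (induction m)
  case 0
  then show ?case using P_carrier by simp
next
  case (Suc m)
  have "x [^] Suc m \<otimes> p = x \<otimes> (x [^] m \<otimes> p)"
    using x P_carrier[OF Suc.prems] nat_pow_closed[OF x, of m] by (simp add: m_ac)
  with P_shift[OF Suc.IH[OF Suc.prems]] show ?case by simp
qed

lemma P_mult: "p \<in> P n \<Longrightarrow> q \<in> P m \<Longrightarrow> p \<otimes> q \<in> P (n + m)"
proof (induction m arbitrary: q)
  case 0
  then show ?case using P_carrier P_zero by simp
next
  case (Suc m)
  then obtain q' c where q: "q' \<in> P m" "c \<in> A" "q = q' \<oplus> c \<otimes> x [^] m" by auto
  have carr: "p \<in> carrier R" "q' \<in> carrier R" "c \<in> carrier R" "x [^] m \<in> carrier R"
    using q Suc.prems P_carrier A_carrier x by auto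
  have "p \<otimes> q = p \<otimes> q' \<oplus> c \<otimes> (x [^] m \<otimes> p)"
    unfolding q using carr by algebra
  moreover have "p \<otimes> q' \<in> P (n + m)" "c \<otimes> (x [^] m \<otimes> p) \<in> P (n + m)"
    using Suc q P_smult P_pow_mult by auto
  ultimately have "p \<otimes> q \<in> P (n + m)" using P_add by simp
  then show ?case using P_mono[of "n + m" "n + Suc m"] by auto
qed

lemma gens_carrier: "insert x A \<subseteq> carrier R"
  using A_carrier x by blast

lemma Ax_subring: "subring Ax R"
  by (rule generate_ring_is_subring[OF gens_carrier])

lemma A_subset_Ax: "A \<subseteq> Ax"
  by (auto intro: generate_ring.incl)

lemma x_in_Ax: "x \<in> Ax"
  by (auto intro: generate_ring.incl)

lemma pow_in_Ax: "x [^] (n::nat) \<in> Ax"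
  by (induction n) (auto intro: generate_ring.one generate_ring.eng_mult x_in_Ax)

lemma P_subset_Ax: "P n \<subseteq> Ax"
proof (induction n)
  case 0
  then show ?case using subringE(2)[OF Ax_subring] by simp
next
  case (Suc n)
  then show ?case
    using A_subset_Ax pow_in_Ax by (auto intro!: generate_ring.eng_add generate_ring.eng_mult)
qed

lemma Ax_eq_Union_P: "Ax = (\<Union>n. P n)"
proof (rule generate_ringI[OF gens_carrier, symmetric])
  have one: "P 1 = A"
    using A_carrier by force
  show "subring (\<Union>n. P n) R"
  proof (rule subringI)
    show "(\<Union>n. P n) \<subseteq> carrier R" using P_carrier by blast
    show "\<one> \<in> (\<Union>n. P n)" using one subringE(3)[OF A] by blast
    show "\<ominus> p \<in> (\<Union>n. P n)" if p: "p \<in> (\<Union>n. P n)" for p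
    proof -
      have "\<ominus> p = \<ominus> \<one> \<otimes> p" using p P_carrier by (auto simp: l_minus)
      then show ?thesis using p P_smult[of "\<ominus> \<one>" p] subringE(3,5)[OF A] by auto
    qed
    show "p \<otimes> q \<in> (\<Union>n. P n)" if "p \<in> (\<Union>n. P n)" "q \<in> (\<Union>n. P n)" for p q
      using that P_mult by blast
    show "p \<oplus> q \<in> (\<Union>n. P n)" if pq: "p \<in> (\<Union>n. P n)" "q \<in> (\<Union>n. P n)" for p q
    proof -
      obtain n m where "p \<in> P n" "q \<in> P m" using pq by blast
      then have "p \<in> P (max n m)" "q \<in> P (max n m)"
        using P_mono[of n "max n m"] P_mono[of m "max n m"] by auto
      then show ?thesis using P_add by blast
    qed
  qed
  have "x = \<zero> \<oplus> \<one> \<otimes> x [^] Suc 0" using x by simp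
  then have "x \<in> P (Suc (Suc 0))"
    unfolding poly_values.simps(2)[of R A x "Suc 0"] using P_zero subringE(3)[OF A] by blast
  with one show "insert x A \<subseteq> (\<Union>n. P n)" by blast
  show "(\<Union>n. P n) \<subseteq> K" if "subring K R" "insert x A \<subseteq> K" for K
    using generate_ring_min_subring1[OF gens_carrier that] P_subset_Ax by blast
qed

lemma LC_ideal:
  assumes I: "ideal I (R\<lparr>carrier := Ax\<rparr>)"
  shows "ideal (LC I n) (R\<lparr>carrier := A\<rparr>)"
proof (rule ideal_subringI[OF A])
  note D = ideal_subringD[OF I]
  show "LC I n \<subseteq> A" by (auto simp: leading_coeffs_def)
  have "\<zero> \<oplus> \<zero> \<otimes> x [^] n \<in> I" using D(2) x by simp
  then show "\<zero> \<in> LC I n"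
    unfolding leading_coeffs_def using P_zero subringE(2)[OF A] by blast
  show "c \<oplus> d \<in> LC I n" if cd: "c \<in> LC I n" "d \<in> LC I n" for c d
  proof -
    obtain p q where p: "c \<in> A" "p \<in> P n" "p \<oplus> c \<otimes> x [^] n \<in> I"
      and q: "d \<in> A" "q \<in> P n" "q \<oplus> d \<otimes> x [^] n \<in> I"
      using cd unfolding leading_coeffs_def by blast
    have carr: "p \<in> carrier R" "q \<in> carrier R" "c \<in> carrier R" "d \<in> carrier R"
        "x [^] n \<in> carrier R"
      using p q P_carrier A_carrier x by auto
    have "(p \<oplus> q) \<oplus> (c \<oplus> d) \<otimes> x [^] n = (p \<oplus> c \<otimes> x [^] n) \<oplus> (q \<oplus> d \<otimes> x [^] n)"
      using carr by algebra
    then have "(p \<oplus> q) \<oplus> (c \<oplus> d) \<otimes> x [^] n \<in> I" using D(3) p q by simp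
    then show ?thesis
      unfolding leading_coeffs_def using P_add p q subringE(7)[OF A] by blast
  qed
  show "r \<otimes> c \<in> LC I n" if r: "r \<in> A" and c: "c \<in> LC I n" for r c
  proof -
    obtain p where p: "c \<in> A" "p \<in> P n" "p \<oplus> c \<otimes> x [^] n \<in> I"
      using c unfolding leading_coeffs_def by blast
    have carr: "p \<in> carrier R" "c \<in> carrier R" "r \<in> carrier R" "x [^] n \<in> carrier R"
      using p r P_carrier A_carrier x by auto
    have "r \<otimes> p \<oplus> (r \<otimes> c) \<otimes> x [^] n = r \<otimes> (p \<oplus> c \<otimes> x [^] n)"
      using carr by algebra
    then have "r \<otimes> p \<oplus> (r \<otimes> c) \<otimes> x [^] n \<in> I" using D(4) p r A_subset_Ax by auto
    then show ?thesis
      unfolding leading_coeffs_def using P_smult p r subringE(6)[OF A] by blast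
  qed
qed

lemma LC_Suc:
  assumes I: "ideal I (R\<lparr>carrier := Ax\<rparr>)"
  shows "LC I n \<subseteq> LC I (Suc n)"
proof
  fix c assume "c \<in> LC I n"
  then obtain p where p: "c \<in> A" "p \<in> P n" "p \<oplus> c \<otimes> x [^] n \<in> I"
    unfolding leading_coeffs_def by blast
  have carr: "p \<in> carrier R" "c \<in> carrier R" "x [^] n \<in> carrier R"
    using p P_carrier A_carrier x by auto
  have "x \<otimes> p \<oplus> c \<otimes> (x [^] n \<otimes> x) = x \<otimes> (p \<oplus> c \<otimes> x [^] n)"
    using carr x by algebra
  then have "x \<otimes> p \<oplus> c \<otimes> x [^] Suc n \<in> I"
    using ideal_subringD(4)[OF I x_in_Ax p(3)] by simp
  then show "c \<in> LC I (Suc n)"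
    unfolding leading_coeffs_def using P_shift p by blast
qed

lemma LC_mono:
  assumes "ideal I (R\<lparr>carrier := Ax\<rparr>)" "m \<le> n"
  shows "LC I m \<subseteq> LC I n"
  by (rule lift_Suc_mono_le[of "LC I", OF LC_Suc[OF assms(1)] assms(2)])

text \<open>An element of \<open>I\<close> of degree at most \<open>n\<close> has the same leading coefficient as some element of
  \<open>J\<close> of degree at most \<open>n\<close>; their difference has smaller degree and lies in \<open>I\<close> again because
  \<open>J \<subseteq> I\<close>.\<close>

lemma ideal_subset_if_LC_subset:
  assumes I: "ideal I (R\<lparr>carrier := Ax\<rparr>)" and J: "ideal J (R\<lparr>carrier := Ax\<rparr>)"
    and JI: "J \<subseteq> I" and LC: "\<And>n. LC I n \<subseteq> LC J n"
  shows "I \<subseteq> J"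
proof -
  note DI = ideal_subringD[OF I] and DJ = ideal_subringD[OF J]
  have neg1: "\<ominus> \<one> \<in> A" using subringE(3,5)[OF A] by blast
  have "y \<in> I \<Longrightarrow> y \<in> P n \<Longrightarrow> y \<in> J" for y n
  proof (induction n arbitrary: y)
    case 0
    then show ?case using DJ(2) by simp
  next
    case (Suc n)
    then obtain p c where p: "p \<in> P n" "c \<in> A" "y = p \<oplus> c \<otimes> x [^] n" by auto
    with Suc.prems have "c \<in> LC I n" unfolding leading_coeffs_def by blast
    then obtain q where q: "q \<in> P n" "q \<oplus> c \<otimes> x [^] n \<in> J"
      using LC unfolding leading_coeffs_def by blast
    define z where "z = q \<oplus> c \<otimes> x [^] n"
    have carr: "p \<in> carrier R" "q \<in> carrier R" "c \<in> carrier R" "x [^] n \<in> carrier R"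
      using p q P_carrier A_carrier x by auto
    have diff: "y \<oplus> \<ominus> \<one> \<otimes> z = p \<oplus> \<ominus> \<one> \<otimes> q"
      unfolding p z_def using carr by algebra
    have "z \<in> J" using q z_def by simp
    then have "y \<oplus> \<ominus> \<one> \<otimes> z \<in> I"
      using DI(3,4) Suc.prems(1) JI neg1 A_subset_Ax by blast
    moreover have "p \<oplus> \<ominus> \<one> \<otimes> q \<in> P n"
      using P_add P_smult neg1 p q by blast
    ultimately have "y \<oplus> \<ominus> \<one> \<otimes> z \<in> J" using Suc.IH diff by simp
    then have "(y \<oplus> \<ominus> \<one> \<otimes> z) \<oplus> z \<in> J" using DJ(3) \<open>z \<in> J\<close> by blast
    moreover have "(y \<oplus> \<ominus> \<one> \<otimes> z) \<oplus> z = y"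
      unfolding p z_def using carr by algebra
    ultimately show ?case by simp
  qed
  then show ?thesis using DI(1) Ax_eq_Union_P by blast
qed

text \<open>Only finitely many of the ideals \<open>LC I n\<close> are different, since their union is finitely
  generated. Lifting finitely many generators of each of them to \<open>I\<close> gives finitely many elements,
  and an ideal below \<open>I\<close> that contains these has all the leading coefficients of \<open>I\<close>.\<close>

theorem noetherian_simple_extension:
  assumes noeth: "noetherian_ring (R\<lparr>carrier := A\<rparr>)"
  shows "noetherian_ring (R\<lparr>carrier := Ax\<rparr>)"
proof (rule ring.noetherian_ringI_witness[OF subring_is_ring[OF Ax_subring]])
  interpret N: noetherian_ring "R\<lparr>carrier := A\<rparr>" by (rule noeth)
  fix I assume I: "ideal I (R\<lparr>carrier := Ax\<rparr>)"
  note LI = LC_ideal[OF I]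
  have "ideal (\<Union>n. LC I n) (R\<lparr>carrier := A\<rparr>)"
  proof (rule ideal_subringI[OF A])
    show "(\<Union>n. LC I n) \<subseteq> A" using ideal_subringD(1)[OF LI] by blast
    show "\<zero> \<in> (\<Union>n. LC I n)" using ideal_subringD(2)[OF LI] by blast
    show "r \<otimes> c \<in> (\<Union>n. LC I n)" if "r \<in> A" "c \<in> (\<Union>n. LC I n)" for r c
      using that ideal_subringD(4)[OF LI] by blast
    show "c \<oplus> d \<in> (\<Union>n. LC I n)" if cd: "c \<in> (\<Union>n. LC I n)" "d \<in> (\<Union>n. LC I n)" for c d
    proof -
      obtain n m where "c \<in> LC I n" "d \<in> LC I m" using cd by blast
      then have "c \<in> LC I (max n m)" "d \<in> LC I (max n m)"
        using LC_mono[OF I, of n "max n m"] LC_mono[OF I, of m "max n m"] by auto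
      then show ?thesis using ideal_subringD(3)[OF LI] by blast
    qed
  qed
  then obtain S where S: "finite S" "S \<subseteq> (\<Union>n. LC I n)"
      "\<And>J. ideal J (R\<lparr>carrier := A\<rparr>) \<Longrightarrow> S \<subseteq> J \<Longrightarrow> (\<Union>n. LC I n) \<subseteq> J"
    using N.obtain_ideal_generators by blast
  obtain N where "S \<subseteq> LC I N"
    using finite_subset_mono_Union[OF S(1) LC_mono[OF I] S(2)] by blast
  then have stable: "(\<Union>n. LC I n) \<subseteq> LC I N"
    by (rule S(3)[OF LI])
  have "\<forall>n. \<exists>T. finite T \<and> T \<subseteq> LC I n \<and>
      (\<forall>J. ideal J (R\<lparr>carrier := A\<rparr>) \<longrightarrow> T \<subseteq> J \<longrightarrow> LC I n \<subseteq> J)"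
    using N.obtain_ideal_generators[OF LI] by metis
  then obtain T where T: "\<And>n. finite (T n)" "\<And>n. T n \<subseteq> LC I n"
      "\<And>n J. ideal J (R\<lparr>carrier := A\<rparr>) \<Longrightarrow> T n \<subseteq> J \<Longrightarrow> LC I n \<subseteq> J"
    by metis
  have "\<forall>n. \<forall>c \<in> LC I n. \<exists>p \<in> P n. p \<oplus> c \<otimes> x [^] n \<in> I"
    unfolding leading_coeffs_def by blast
  then obtain f where f: "\<And>n c. c \<in> LC I n \<Longrightarrow> f n c \<in> P n"
      "\<And>n c. c \<in> LC I n \<Longrightarrow> f n c \<oplus> c \<otimes> x [^] n \<in> I"
    by metis
  define W where "W = (\<Union>n \<in> {..N}. (\<lambda>c. f n c \<oplus> c \<otimes> x [^] n) ` T n)"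
  have "finite W" unfolding W_def using T(1) by blast
  moreover have "W \<subseteq> I" unfolding W_def using f(2) T(2) by blast
  moreover have "I \<subseteq> J" if J: "ideal J (R\<lparr>carrier := Ax\<rparr>)" "J \<subseteq> I" "W \<subseteq> J" for J
  proof (rule ideal_subset_if_LC_subset[OF I J(1,2)])
    fix n
    have le: "LC I m \<subseteq> LC J m" if "m \<le> N" for m
    proof (rule T(3)[OF LC_ideal[OF J(1)]], rule subsetI)
      fix c assume c: "c \<in> T m"
      then have "f m c \<oplus> c \<otimes> x [^] m \<in> J"
        using J(3) that unfolding W_def by blast
      moreover have "f m c \<in> P m" "c \<in> A"
        using c T(2) f(1) ideal_subringD(1)[OF LI] by blast+
      ultimately show "c \<in> LC J m" unfolding leading_coeffs_def by blast
    qed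
    show "LC I n \<subseteq> LC J n"
    proof (cases "n \<le> N")
      case True
      then show ?thesis by (rule le)
    next
      case False
      then have "LC J N \<subseteq> LC J n" using LC_mono[OF J(1)] by simp
      then show ?thesis using stable le[of N] by blast
    qed
  qed
  ultimately show "\<exists>S \<subseteq> I. finite S \<and>
      (\<forall>J. ideal J (R\<lparr>carrier := Ax\<rparr>) \<longrightarrow> J \<subseteq> I \<longrightarrow> S \<subseteq> J \<longrightarrow> I \<subseteq> J)"
    by blast
qed

end

section \<open>Finitely generated algebras\<close>

context cring
begin

lemma generate_algebra_subring:
  assumes "K \<subseteq> carrier R" "S \<subseteq> carrier R"
  shows "subring (generate_algebra R K S) R"
  unfolding generate_algebra_def by (rule generate_ring_is_subring) (use assms in blast)

lemma generate_algebra_base: "K \<subseteq> generate_algebra R K S"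
  unfolding generate_algebra_def by (auto intro: generate_ring.incl)

lemma generate_algebra_gens: "S \<subseteq> generate_algebra R K S"
  unfolding generate_algebra_def by (auto intro: generate_ring.incl)

lemma generate_algebra_minimal:
  assumes "subring E R" "K \<subseteq> E" "S \<subseteq> E"
  shows "generate_algebra R K S \<subseteq> E"
  unfolding generate_algebra_def
  by (rule generate_ring_min_subring1) (use assms subringE(1)[OF assms(1)] in auto)

lemma generate_algebra_insert:
  assumes "K \<subseteq> carrier R" "S \<subseteq> carrier R" "s \<in> carrier R"
  shows "generate_algebra R K (insert s S) = generate_ring R (insert s (generate_algebra R K S))"
proof (rule subset_antisym)
  have sub: "subring (generate_algebra R K S) R"
    using assms generate_algebra_subring by blast
  have carr: "insert s (generate_algebra R K S) \<subseteq> carrier R"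
    using subringE(1)[OF sub] assms by blast
  note E = generate_ringE[OF carr refl]
  show "generate_algebra R K (insert s S) \<subseteq> generate_ring R (insert s (generate_algebra R K S))"
    by (rule generate_algebra_minimal[OF E(1)])
       (use E(2) generate_algebra_base[of K S] generate_algebra_gens[of S K] in auto)
  have sub': "subring (generate_algebra R K (insert s S)) R"
    using assms generate_algebra_subring by simp
  have gens: "insert s S \<subseteq> generate_algebra R K (insert s S)"
    by (rule generate_algebra_gens)
  then have "generate_algebra R K S \<subseteq> generate_algebra R K (insert s S)"
    using generate_algebra_minimal[OF sub' generate_algebra_base] by blast
  then show "generate_ring R (insert s (generate_algebra R K S)) \<subseteq> generate_algebra R K (insert s S)"
    using E(3)[OF sub'] gens by blast
qed

lemma fin_gen_algebra_subring:
  assumes "K \<subseteq> carrier R" "fin_gen_algebra R K A"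
  shows "subring A R" "K \<subseteq> A"
proof -
  obtain S where S: "S \<subseteq> carrier R" "A = generate_algebra R K S"
    using assms(2) unfolding fin_gen_algebra_def by blast
  show "subring A R" unfolding S(2) by (rule generate_algebra_subring[OF assms(1) S(1)])
  show "K \<subseteq> A" unfolding S(2) by (rule generate_algebra_base)
qed

theorem noetherian_fin_gen_algebra:
  assumes K: "subring K R" and noeth: "noetherian_ring (R\<lparr>carrier := K\<rparr>)"
    and A: "fin_gen_algebra R K A"
  shows "noetherian_ring (R\<lparr>carrier := A\<rparr>)"
proof -
  note Kc = subringE(1)[OF K]
  obtain S where S: "finite S" "S \<subseteq> carrier R" "A = generate_algebra R K S"
    using A unfolding fin_gen_algebra_def by blast
  from S(1,2) have "noetherian_ring (R\<lparr>carrier := generate_algebra R K S\<rparr>)"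
  proof (induction rule: finite_induct)
    case empty
    have "generate_algebra R K {} = K"
      using generate_algebra_minimal[OF K subset_refl] generate_algebra_base by blast
    with noeth show ?case by simp
  next
    case (insert s S)
    interpret simple_ring_extension R "generate_algebra R K S" s
      by (intro simple_ring_extension.intro simple_ring_extension_axioms.intro cring_axioms)
         (use insert.prems generate_algebra_subring[OF Kc] in auto)
    show ?case
      using noetherian_simple_extension insert generate_algebra_insert[OF Kc] by simp
  qed
  with S(3) show ?thesis by simp
qed

end

section \<open>Dividing by an element of a subring\<close>

context field
begin

lemma inv_mult_cancel:
  assumes "a \<in> carrier R" "a \<noteq> \<zero>" "b \<in> carrier R"
  shows "inv a \<in> carrier R" "inv a \<otimes> (a \<otimes> b) = b" "a \<otimes> (inv a \<otimes> b) = b"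
proof -
  have u: "a \<in> Units R" using assms field_Units by blast
  then show i: "inv a \<in> carrier R" by simp
  show "inv a \<otimes> (a \<otimes> b) = b" using u i assms by (simp add: m_assoc[symmetric])
  show "a \<otimes> (inv a \<otimes> b) = b" using u i assms by (simp add: m_assoc[symmetric])
qed

text \<open>Every \<open>b \<in> A\<close> is itself a quotient, namely \<open>a\<^sup>-\<^sup>1 (a b)\<close>.\<close>

lemma subset_generate_algebra_quotients:
  assumes A: "subring A R" and AC: "A \<subseteq> C" and a: "a \<in> A" "a \<noteq> \<zero>"
  shows "A \<subseteq> generate_algebra R K ({inv a \<otimes> b | b. b \<in> A} \<inter> C)"
proof
  fix b assume b: "b \<in> A"
  then have "b = inv a \<otimes> (a \<otimes> b)" "a \<otimes> b \<in> A"
    using a inv_mult_cancel(2)[of a b] subringE(6)[OF A] subsetD[OF subringE(1)[OF A]] by auto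
  then have "b \<in> {inv a \<otimes> b | b. b \<in> A} \<inter> C" using b AC by blast
  then show "b \<in> generate_algebra R K ({inv a \<otimes> b | b. b \<in> A} \<inter> C)"
    by (rule subsetD[OF generate_algebra_gens])
qed

lemma ideal_of_multiples:
  assumes A: "subring A R" and C: "subring C R" and AC: "A \<subseteq> C"
    and a: "a \<in> A" "a \<noteq> \<zero>"
  shows "ideal {b \<in> A. inv a \<otimes> b \<in> C} (R\<lparr>carrier := A\<rparr>)"
proof (rule ideal_subringI[OF A])
  have Ac: "\<And>b. b \<in> A \<Longrightarrow> b \<in> carrier R" using subringE(1)[OF A] by blast
  have i: "inv a \<in> carrier R" using a Ac inv_mult_cancel(1) by blast
  show "\<zero> \<in> {b \<in> A. inv a \<otimes> b \<in> C}"
    using i subringE(2)[OF A] subringE(2)[OF C] by simp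
  show "b \<oplus> c \<in> {b \<in> A. inv a \<otimes> b \<in> C}"
    if "b \<in> {b \<in> A. inv a \<otimes> b \<in> C}" "c \<in> {b \<in> A. inv a \<otimes> b \<in> C}" for b c
    using that i Ac subringE(7)[OF A] subringE(7)[OF C] by (simp add: r_distr)
  show "r \<otimes> b \<in> {b \<in> A. inv a \<otimes> b \<in> C}"
    if "r \<in> A" "b \<in> {b \<in> A. inv a \<otimes> b \<in> C}" for r b
    using that i Ac AC subringE(6)[OF A] subringE(6)[OF C, of r "inv a \<otimes> b"]
    by (auto simp: m_lcomm)
qed auto

text \<open>The numerators \<open>b \<in> A\<close> with \<open>a\<^sup>-\<^sup>1 b \<in> C\<close> form an ideal of the Noetherian ring \<open>A\<close>, so
  finitely many of these quotients generate all others over \<open>A\<close>.\<close>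

lemma fin_gen_algebra_quotients:
  assumes K: "subring K R" "noetherian_ring (R\<lparr>carrier := K\<rparr>)"
    and A: "fin_gen_algebra R K A" and C: "subring C R" and AC: "A \<subseteq> C"
    and a: "a \<in> A" "a \<noteq> \<zero>"
  shows "fin_gen_algebra R K (generate_algebra R K ({inv a \<otimes> b | b. b \<in> A} \<inter> C))"
proof -
  note Kc = subringE(1)[OF K(1)]
  note As = fin_gen_algebra_subring[OF Kc A]
  interpret N: noetherian_ring "R\<lparr>carrier := A\<rparr>"
    by (rule noetherian_fin_gen_algebra[OF K A])
  define Q where "Q = {inv a \<otimes> b | b. b \<in> A} \<inter> C"
  have Qc: "Q \<subseteq> carrier R" unfolding Q_def using subringE(1)[OF C] by blast
  obtain T where T: "finite T" "T \<subseteq> carrier R" "A = generate_algebra R K T"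
    using A unfolding fin_gen_algebra_def by blast
  obtain S where S: "finite S" "S \<subseteq> {b \<in> A. inv a \<otimes> b \<in> C}"
      "\<And>J. ideal J (R\<lparr>carrier := A\<rparr>) \<Longrightarrow> S \<subseteq> J \<Longrightarrow> {b \<in> A. inv a \<otimes> b \<in> C} \<subseteq> J"
    using N.obtain_ideal_generators[OF ideal_of_multiples[OF As(1) C AC a]] by blast
  define F where "F = T \<union> (\<lambda>b. inv a \<otimes> b) ` S"
  define D where "D = generate_algebra R K F"
  have SQ: "(\<lambda>b. inv a \<otimes> b) ` S \<subseteq> Q" unfolding Q_def using S(2) by blast
  have Fc: "F \<subseteq> carrier R" unfolding F_def using T(2) SQ Qc by blast
  have D: "subring D R" "K \<subseteq> D" "F \<subseteq> D"
    unfolding D_def using generate_algebra_subring[OF Kc Fc] generate_algebra_base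
      generate_algebra_gens by auto
  have AD: "A \<subseteq> D" unfolding T(3)
    by (rule generate_algebra_minimal[OF D(1,2)]) (use D(3) F_def in blast)
  have "{b \<in> A. inv a \<otimes> b \<in> C} \<subseteq> {b \<in> A. inv a \<otimes> b \<in> D}"
  proof (rule S(3)[OF ideal_of_multiples[OF As(1) D(1) AD a]])
    show "S \<subseteq> {b \<in> A. inv a \<otimes> b \<in> D}"
      using S(2) D(3) unfolding F_def by blast
  qed
  then have "Q \<subseteq> D" unfolding Q_def by blast
  then have "generate_algebra R K Q \<subseteq> D"
    by (rule generate_algebra_minimal[OF D(1,2)])
  moreover have "F \<subseteq> generate_algebra R K Q"
    using subset_generate_algebra_quotients[OF As(1) AC a, of K] generate_algebra_gens[of T K]
      generate_algebra_gens[of Q K] SQ T(3) unfolding F_def Q_def by blast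
  then have "D \<subseteq> generate_algebra R K Q"
    unfolding D_def
    by (rule generate_algebra_minimal[OF generate_algebra_subring[OF Kc Qc] generate_algebra_base])
  ultimately have "generate_algebra R K Q = D" by blast
  moreover have "finite F" unfolding F_def using T(1) S(1) by blast
  ultimately show ?thesis
    unfolding fin_gen_algebra_def Q_def D_def using Fc by blast
qed

text \<open>The elements carried into \<open>B\<close> by some power of \<open>a\<close> form a subring that contains \<open>B\<close> and
  \<open>a\<^sup>-\<^sup>1\<close>.\<close>

lemma localize_at_denominator:
  assumes B: "subring B R" and a: "a \<in> B" "a \<noteq> \<zero>" and y: "y \<in> localize_at R B a"
  shows "\<exists>n::nat. a [^] n \<otimes> y \<in> B"
proof -
  define E where "E = {y \<in> carrier R. \<exists>n::nat. a [^] n \<otimes> y \<in> B}"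
  have Bc: "\<And>b. b \<in> B \<Longrightarrow> b \<in> carrier R" using subringE(1)[OF B] by blast
  note ac = Bc[OF a(1)]
  have i: "inv a \<in> carrier R" using inv_mult_cancel(1) ac a(2) by blast
  have pw: "a [^] (n::nat) \<in> B" for n
    by (induction n) (use a subringE(3,6)[OF B] in auto)
  have pc: "a [^] (n::nat) \<in> carrier R" for n using ac by simp
  have "subring E R"
  proof (rule subringI)
    show "E \<subseteq> carrier R" unfolding E_def by blast
    have "a [^] (0::nat) \<otimes> \<one> \<in> B" using subringE(3)[OF B] by simp
    then show "\<one> \<in> E" unfolding E_def by blast
    show "\<ominus> y \<in> E" if yE: "y \<in> E" for y
    proof -
      obtain n :: nat where n: "y \<in> carrier R" "a [^] n \<otimes> y \<in> B" using yE unfolding E_def by blast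
      have "a [^] n \<otimes> (\<ominus> y) = \<ominus> (a [^] n \<otimes> y)" using n pc by (simp add: r_minus)
      then have "a [^] n \<otimes> (\<ominus> y) \<in> B" using n subringE(5)[OF B] by simp
      then show ?thesis unfolding E_def using n(1) by blast
    qed
    fix y z assume yz: "y \<in> E" "z \<in> E"
    then obtain n m :: nat where n: "y \<in> carrier R" "a [^] n \<otimes> y \<in> B"
      and m: "z \<in> carrier R" "a [^] m \<otimes> z \<in> B"
      unfolding E_def by blast
    have split: "a [^] (n + m) = a [^] n \<otimes> a [^] m"
      using ac by (simp add: nat_pow_mult)
    have "a [^] (n + m) \<otimes> (y \<otimes> z) = (a [^] n \<otimes> y) \<otimes> (a [^] m \<otimes> z)"
      unfolding split using n(1) m(1) pc[of n] pc[of m] by algebra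
    then have "a [^] (n + m) \<otimes> (y \<otimes> z) \<in> B" using n m subringE(6)[OF B] by simp
    then show "y \<otimes> z \<in> E" unfolding E_def using n(1) m(1) by blast
    have "a [^] (n + m) \<otimes> (y \<oplus> z) =
        a [^] m \<otimes> (a [^] n \<otimes> y) \<oplus> a [^] n \<otimes> (a [^] m \<otimes> z)"
      unfolding split using n(1) m(1) pc[of n] pc[of m] by algebra
    then have "a [^] (n + m) \<otimes> (y \<oplus> z) \<in> B" using n m pw subringE(6,7)[OF B] by simp
    then show "y \<oplus> z \<in> E" unfolding E_def using n(1) m(1) by blast
  qed
  moreover have "B \<union> {inv a} \<subseteq> E"
  proof -
    have "a [^] (0::nat) \<otimes> b \<in> B" if "b \<in> B" for b using that Bc by simp
    moreover have "a [^] (1::nat) \<otimes> inv a \<in> B"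
      using ac a field_Units subringE(3)[OF B] by simp
    ultimately show ?thesis unfolding E_def using Bc i by blast
  qed
  ultimately have "localize_at R B a \<subseteq> E"
    unfolding localize_at_def by (intro generate_ring_min_subring1) (use Bc i in auto)
  with y show ?thesis unfolding E_def by blast
qed

end

section \<open>Invariants\<close>

lemma (in field_action) fixed_points_subring:
  assumes "subring A L"
  shows "subring (fixed_points G \<phi> A) L"
proof -
  have Ac: "\<And>x. x \<in> A \<Longrightarrow> x \<in> carrier L" using subringE(1)[OF assms] by blast
  have hom: "\<phi> g \<in> ring_hom L L" if "g \<in> carrier G" for g
    using acts_by_automorphisms[OF that] unfolding ring_iso_def by blast
  have neg: "\<phi> g (\<ominus> x) = \<ominus> \<phi> g x" if "g \<in> carrier G" "x \<in> carrier L" for g x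
  proof -
    interpret ring_hom_ring L L "\<phi> g"
      by (rule ring_hom_ringI2[OF ring_axioms ring_axioms hom[OF that(1)]])
    show ?thesis using that(2) by simp
  qed
  show ?thesis
    by (rule subringI)
       (use Ac neg subringE[OF assms] ring_hom_one[OF hom] ring_hom_mult[OF hom]
          ring_hom_add[OF hom] in \<open>auto simp: fixed_points_def\<close>)
qed

lemma (in field_action) fixed_points_divide:
  assumes a: "a \<in> fixed_points G \<phi> (carrier L)" "a \<noteq> \<zero>"
    and b: "b \<in> fixed_points G \<phi> (carrier L)"
  shows "inv a \<otimes> b \<in> fixed_points G \<phi> (carrier L)"
proof -
  have ab: "a \<in> carrier L" "b \<in> carrier L" using a b unfolding fixed_points_def by auto
  note c = inv_mult_cancel[OF ab(1) a(2)]
  have q: "inv a \<otimes> b \<in> carrier L" using c(1)[OF ab(2)] ab by simp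
  have "\<phi> g (inv a \<otimes> b) = inv a \<otimes> b" if g: "g \<in> carrier G" for g
  proof -
    note iso = ring_iso_memE[OF acts_by_automorphisms[OF g]]
    have "a \<otimes> \<phi> g (inv a \<otimes> b) = \<phi> g a \<otimes> \<phi> g (inv a \<otimes> b)"
      using a(1) g unfolding fixed_points_def by simp
    also have "\<dots> = \<phi> g (a \<otimes> (inv a \<otimes> b))" using iso(2) ab q by simp
    also have "\<dots> = b" using c(3)[OF ab(2)] b g unfolding fixed_points_def by simp
    finally have "inv a \<otimes> (a \<otimes> \<phi> g (inv a \<otimes> b)) = inv a \<otimes> b" by simp
    then show ?thesis using c(2)[OF iso(1)[OF q]] by simp
  qed
  with q show ?thesis unfolding fixed_points_def by blast
qed

theorem theorem1p10:
  fixes L :: "('l, 'm) ring_scheme"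
    and G :: "('g, 'n) monoid_scheme"
    and \<phi> :: "'g \<Rightarrow> 'l \<Rightarrow> 'l"
    and K R B :: "'l set"
    and a :: 'l
  assumes "field_action L G \<phi>"
    and "subring K L"
    and "K \<subseteq> fixed_points G \<phi> (carrier L)"
    and "fin_gen_algebra L K R"
    and "\<And>g x. g \<in> carrier G \<Longrightarrow> x \<in> R \<Longrightarrow> \<phi> g x \<in> R"
    and "quot_field L R = carrier L"
    and "fin_gen_algebra L K B"
    and "B \<subseteq> fixed_points G \<phi> R"
    and "a \<in> B"
    and "a \<noteq> \<zero>\<^bsub>L\<^esub>"
    and "localize_at L (fixed_points G \<phi> R) a = localize_at L B a"
  shows "(\<forall>k. ring_subalgebra L K (algebra_chain L K R a B k) \<and>
              algebra_chain L K R a B k \<subseteq> R \<and>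
              algebra_chain L K R a B k \<subseteq> algebra_chain L K R a B (Suc k)) \<and>
         fixed_points G \<phi> R = (\<Union>k. algebra_chain L K R a B k) \<and>
         (noetherian_ring (L\<lparr>carrier := K\<rparr>) \<longrightarrow>
            (\<forall>k. fin_gen_algebra L K (algebra_chain L K R a B k))) \<and>
         (\<forall>k. algebra_chain L K R a B k = algebra_chain L K R a B (Suc k) \<longrightarrow>
            fixed_points G \<phi> R = algebra_chain L K R a B k) \<and>
         (fin_gen_algebra L K (fixed_points G \<phi> R) \<longrightarrow>
            (\<exists>k. algebra_chain L K R a B k = algebra_chain L K R a B (Suc k)))"
proof -
  interpret field_action L G \<phi> by fact
  define I where "I = fixed_points G \<phi> R"
  define C where "C = algebra_chain L K R a B"
  note Kc = subringE(1)[OF assms(2)]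
  note Rs = fin_gen_algebra_subring[OF Kc assms(4)]
  note Bs = fin_gen_algebra_subring[OF Kc assms(7)]
  have Isub: "subring I L" unfolding I_def by (rule fixed_points_subring[OF Rs(1)])
  have Ieq: "I = R \<inter> fixed_points G \<phi> (carrier L)"
    unfolding I_def fixed_points_def using subringE(1)[OF Rs(1)] by blast
  have KI: "K \<subseteq> I" using assms(3) Rs(2) Ieq by blast
  have aI: "a \<in> I" using assms(8,9) I_def by blast
  have CSuc: "C (Suc k) = generate_algebra L K ({inv\<^bsub>L\<^esub> a \<otimes>\<^bsub>L\<^esub> b | b. b \<in> C k} \<inter> R)" for k
    unfolding C_def by simp
  have quot_in_I: "inv\<^bsub>L\<^esub> a \<otimes>\<^bsub>L\<^esub> b \<in> I" if "b \<in> I" "inv\<^bsub>L\<^esub> a \<otimes>\<^bsub>L\<^esub> b \<in> R" for b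
    using that fixed_points_divide[of a b] aI assms(10) Ieq by blast
  have chain: "subring (C k) L \<and> K \<subseteq> C k \<and> a \<in> C k \<and> C k \<subseteq> I" for k
  proof (induction k)
    case 0
    then show ?case using Bs assms(8,9) unfolding C_def I_def by simp
  next
    case (Suc k)
    let ?Q = "{inv\<^bsub>L\<^esub> a \<otimes>\<^bsub>L\<^esub> b | b. b \<in> C k} \<inter> R"
    have "?Q \<subseteq> carrier L" using subringE(1)[OF Rs(1)] by blast
    then have sub: "subring (C (Suc k)) L"
      unfolding CSuc by (rule generate_algebra_subring[OF Kc])
    have "C k \<subseteq> C (Suc k)"
      unfolding CSuc
      by (rule subset_generate_algebra_quotients) (use Suc assms(10) Ieq in auto)
    moreover have "?Q \<subseteq> I" using quot_in_I Suc by blast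
    then have "C (Suc k) \<subseteq> I"
      unfolding CSuc by (rule generate_algebra_minimal[OF Isub KI])
    ultimately show ?case using Suc sub by blast
  qed
  have step: "C k \<subseteq> C (Suc k)" for k
    unfolding CSuc
    by (rule subset_generate_algebra_quotients) (use chain[of k] assms(10) Ieq in auto)
  have mono: "C m \<subseteq> C n" if "m \<le> n" for m n
    by (rule lift_Suc_mono_le[of C, OF step that])
  \<comment> \<open>The intermediate products \<open>a\<^sup>j y\<close> are invariants in \<open>R\<close>, so the powers of \<open>a\<close> can be
      stripped one at a time, each at the cost of one step up the chain.\<close>
  have divide: "y \<in> C (k + n)" if "y \<in> I" "a [^]\<^bsub>L\<^esub> n \<otimes>\<^bsub>L\<^esub> y \<in> C k" for y k and n :: nat
    using that
  proof (induction n arbitrary: k)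
    case 0
    then show ?case using subringE(1)[OF Isub] by auto
  next
    case (Suc n)
    define z where "z = a [^]\<^bsub>L\<^esub> n \<otimes>\<^bsub>L\<^esub> y"
    have ac: "a \<in> carrier L" and yc: "y \<in> carrier L"
      using aI Suc.prems(1) subringE(1)[OF Isub] by auto
    have "a [^]\<^bsub>L\<^esub> m \<in> I" for m :: nat
      by (induction m) (use aI subringE(3,6)[OF Isub] in auto)
    then have zI: "z \<in> I"
      unfolding z_def using Suc.prems(1) subringE(6)[OF Isub] by blast
    have zc: "z \<in> carrier L" using zI subringE(1)[OF Isub] by blast
    have "a [^]\<^bsub>L\<^esub> Suc n \<otimes>\<^bsub>L\<^esub> y = a \<otimes>\<^bsub>L\<^esub> z"
      unfolding z_def using ac yc nat_pow_closed[OF ac, of n] by (simp add: m_ac)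
    then have "a \<otimes>\<^bsub>L\<^esub> z \<in> C k" using Suc.prems(2) by simp
    moreover have "z = inv\<^bsub>L\<^esub> a \<otimes>\<^bsub>L\<^esub> (a \<otimes>\<^bsub>L\<^esub> z)"
      using inv_mult_cancel(2)[OF ac assms(10) zc] by simp
    ultimately have "z \<in> {inv\<^bsub>L\<^esub> a \<otimes>\<^bsub>L\<^esub> b | b. b \<in> C k} \<inter> R" using zI Ieq by blast
    then have "z \<in> C (Suc k)" unfolding CSuc by (rule subsetD[OF generate_algebra_gens])
    then show ?case using Suc.IH[of "Suc k"] Suc.prems(1) z_def by simp
  qed
  have union: "I = (\<Union>k. C k)"
  proof (rule subset_antisym)
    show "(\<Union>k. C k) \<subseteq> I" using chain by blast
    show "I \<subseteq> (\<Union>k. C k)"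
    proof
      fix y assume y: "y \<in> I"
      then have "y \<in> localize_at L I a"
        unfolding localize_at_def by (auto intro: generate_ring.incl)
      then have "y \<in> localize_at L B a" using assms(11) I_def by simp
      then obtain n :: nat where "a [^]\<^bsub>L\<^esub> n \<otimes>\<^bsub>L\<^esub> y \<in> B"
        using localize_at_denominator[OF Bs(1) assms(9,10)] by blast
      then have "a [^]\<^bsub>L\<^esub> n \<otimes>\<^bsub>L\<^esub> y \<in> C 0" unfolding C_def by simp
      then show "y \<in> (\<Union>k. C k)" using divide[OF y, of n 0] by blast
    qed
  qed
  have fin_gen: "fin_gen_algebra L K (C k)" if "noetherian_ring (L\<lparr>carrier := K\<rparr>)" for k
  proof (induction k)
    case 0
    then show ?case using assms(7) unfolding C_def by simp
  next
    case (Suc k)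
    show ?case
      unfolding CSuc
      by (rule fin_gen_algebra_quotients[OF assms(2) that Suc Rs(1)])
         (use chain[of k] assms(10) Ieq in auto)
  qed
  have stationary: "I = C k" if eq: "C k = C (Suc k)" for k
  proof -
    have "C (k + j) = C k" for j
    proof (induction j)
      case (Suc j)
      have "C (k + Suc j) = C (Suc k)" using CSuc[of "k + j"] CSuc[of k] Suc by simp
      with eq show ?case by simp
    qed simp
    then have "C j \<subseteq> C k" for j using mono[of j "k + j"] by simp
    then show ?thesis using union by blast
  qed
  have stops: "\<exists>k. C k = C (Suc k)" if fgI: "fin_gen_algebra L K I"
  proof -
    obtain S where S: "finite S" "I = generate_algebra L K S"
      using fgI unfolding fin_gen_algebra_def by blast
    have "S \<subseteq> (\<Union>k. C k)"
      unfolding union[symmetric] S(2) by (rule generate_algebra_gens)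
    then obtain k where k: "S \<subseteq> C k"
      using finite_subset_mono_Union[of S C, OF S(1) mono] by auto
    have "generate_algebra L K S \<subseteq> C k"
      by (rule generate_algebra_minimal) (use chain[of k] k in auto)
    then have "I \<subseteq> C k" using S(2) by simp
    then show ?thesis using step[of k] chain[of "Suc k"] by blast
  qed
  have sub: "subring (C k) L" "K \<subseteq> C k" "C k \<subseteq> R" for k
    using chain[of k] Ieq by auto
  show ?thesis
    unfolding ring_subalgebra_def C_def[symmetric] I_def[symmetric]
    by (intro conjI allI impI)
       (rule sub step union | erule fin_gen stationary stops)+
qed

end
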